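(* Let $G$ be a sharply 2-transitive group with $\mathrm{char}(G)\neq 2$, let $J$ be its set of involutions, and assume that commuting is a transitive relation on $J^2\setminus\{1\}$. Then $J$ contains no proper projective plane, i.e.: if $X\subseteq J$ is a subset satisfying (a) for all $i\neq j$ in $X$, $\ell_{ij}\subseteq X$, and (b) if $\lambda$ and $\delta$ are lines contained in $X$, then $\lambda\cap\delta\neq\emptyset$, then $X$ contains at most one line.
   Context: A permutation group $G$ acting on a set $\Omega$ with $|\Omega|\geq 2$ is sharply 2-transitive if it acts regularly on ordered pairs of distinct points. Then the set $J$ of involutions (elements of order 2) of $G$ is non-empty and forms a single conjugacy class. Put $J^2=\{ij : i,j\in J\}$; elements of $J^2$ are called translations. One sets $\mathrm{char}(G)=2$ if and only if involutions have no fixed points in $\Omega$. If involutions have a (necessarily unique) fixed point, the action of $G$ on $\Omega$ is identified with the conjugation action of $G$ on $J$; the nontrivial translations then form a single conjugacy class, and $\mathrm{char}(G)=p$ (respectively $0$) if nontrivial translations have order $p$ (respectively infinite order). "Commuting is transitive on $J^2\setminus\{1\}$" means: for $\rho,\sigma,\tau\in J^2\setminus\{1\}$, if $\rho\sigma=\sigma\rho$ and $\sigma\tau=\tau\sigma$ then $\rho\tau=\tau\rho$. Point-line geometry: the points are the elements of $J$; for $i\neq j$ in $J$ the line through $i$ and $j$ is $$\ell_{ij}=\{k\in J : ij\in kJ\},\qquad kJ=\{kr : r\in J\}.$$ A line is a subset of $J$ of the form $\ell_{ij}$ with $i\neq j$ in $J$. *)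

theory Defs
  imports "HOL-Algebra.Algebra"
begin

locale sharply_2_transitive = faithful_action G \<Omega> \<phi>
  for G (structure) and \<Omega> and \<phi> +
  assumes two_points: "\<exists>a\<in>\<Omega>. \<exists>b\<in>\<Omega>. a \<noteq> b"
    and regular_on_pairs:
      "\<lbrakk>a \<in> \<Omega>; b \<in> \<Omega>; a \<noteq> b; c \<in> \<Omega>; d \<in> \<Omega>; c \<noteq> d\<rbrakk>
        \<Longrightarrow> \<exists>!g. g \<in> carrier G \<and> \<phi> g a = c \<and> \<phi> g b = d"

definition involutions :: "('a, 'm) monoid_scheme \<Rightarrow> 'a set"
  where "involutions G = {g \<in> carrier G. group.ord G g = 2}"

definition group_translations :: "('a, 'm) monoid_scheme \<Rightarrow> 'a set"
  where "group_translations G = involutions G <#>\<^bsub>G\<^esub> involutions G"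

(* If involutions have fixed points, the nontrivial translations are all conjugate, so the
   definite description denotes their common order; group.ord is 0 for infinite order. *)
definition s2t_char :: "('a, 'm) monoid_scheme \<Rightarrow> 'b set \<Rightarrow> ('a \<Rightarrow> 'b \<Rightarrow> 'b) \<Rightarrow> nat"
  where "s2t_char G \<Omega> \<phi> =
    (if \<forall>i\<in>involutions G. invariants \<Omega> \<phi> i = {} then 2
     else (THE n. \<forall>t\<in>group_translations G - {\<one>\<^bsub>G\<^esub>}. group.ord G t = n))"

definition commuting_transitive_on :: "('a, 'm) monoid_scheme \<Rightarrow> 'a set \<Rightarrow> bool"
  where "commuting_transitive_on G S \<longleftrightarrow>
    (\<forall>\<rho>\<in>S. \<forall>\<sigma>\<in>S. \<forall>\<tau>\<in>S.
       \<rho> \<otimes>\<^bsub>G\<^esub> \<sigma> = \<sigma> \<otimes>\<^bsub>G\<^esub> \<rho> \<and> \<sigma> \<otimes>\<^bsub>G\<^esub> \<tau> = \<tau> \<otimes>\<^bsub>G\<^esub> \<sigma> \<longrightarrow> \<rho> \<otimes>\<^bsub>G\<^esub> \<tau> = \<tau> \<otimes>\<^bsub>G\<^esub> \<rho>)"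

definition line_through :: "('a, 'm) monoid_scheme \<Rightarrow> 'a \<Rightarrow> 'a \<Rightarrow> 'a set"
  where "line_through G i j =
    {k \<in> involutions G. i \<otimes>\<^bsub>G\<^esub> j \<in> k <#\<^bsub>G\<^esub> involutions G}"

definition lines :: "('a, 'm) monoid_scheme \<Rightarrow> 'a set set"
  where "lines G = {line_through G i j | i j. i \<in> involutions G \<and> j \<in> involutions G \<and> i \<noteq> j}"

end

theory Submission
  imports Defs
begin

text \<open>
  Distinct involutions never commute: since the characteristic is not 2, every involution has
  exactly one fixed point in \<open>\<Omega>\<close>, an involution commuting with it fixes the same point, and two
  involutions with a common fixed point are equal
  (\<open>commuting_involutions_eq\<close>). As a consequence, the line through \<open>i\<close> and \<open>j\<close> consists of
  the involutions that invert the translation \<open>i j\<close> (\<open>line_through_iff_inverts\<close>), and a point \<open>p\<close>,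
  acting on the points by conjugation, fixes no point but itself.

  The geometry behind the theorem is that each point \<open>p\<close> of the set \<open>S\<close> acts on \<open>S\<close> as a
  collineation of order 2 with centre \<open>p\<close> and no other fixed point, whereas in a projective plane
  a collineation with a centre also has an axis. In detail, let \<open>M\<close> be a line contained in \<open>S\<close> and
  \<open>p\<close> any point of \<open>S\<close>. The conjugate line \<open>p M p\<close> again lies in \<open>S\<close>, hence it meets \<open>M\<close> in some
  point \<open>q\<close>, and then both \<open>q\<close> and its mirror image \<open>p q p\<close> lie on \<open>M\<close>. If \<open>q = p\<close>, then
  \<open>p\<close> is on \<open>M\<close>. Otherwise \<open>q \<noteq> p q p\<close>, and transitivity of commuting shows
  that \<open>M\<close>, being a line through \<open>q\<close> and \<open>p q p\<close>, passes through \<open>p\<close>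
  (\<open>midpoint_in_line_through\<close>). So every line contained in \<open>S\<close> is equal to \<open>S\<close>.
\<close>

section \<open>Involutions of a group and their lines\<close>

context group
begin

lemma involutions_iff:
  "i \<in> involutions G \<longleftrightarrow> i \<in> carrier G \<and> i \<noteq> \<one> \<and> i \<otimes> i = \<one>"
proof (cases "i \<in> carrier G")
  case True
  have sq: "i [^] (2::nat) = i \<otimes> i"
    using True by (simp add: numeral_2_eq_2)
  show ?thesis
  proof
    assume "i \<in> involutions G"
    then have o: "ord i = 2" by (simp add: involutions_def)
    have "i \<otimes> i = \<one>" using pow_ord_eq_1[OF True] o sq by simp
    moreover have "i \<noteq> \<one>" using o ord_eq_1[OF True] by auto
    ultimately show "i \<in> carrier G \<and> i \<noteq> \<one> \<and> i \<otimes> i = \<one>" using True by blast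
  next
    assume a: "i \<in> carrier G \<and> i \<noteq> \<one> \<and> i \<otimes> i = \<one>"
    then have "ord i dvd 2" using pow_eq_id[OF True, of 2] sq by simp
    moreover have "ord i \<noteq> 1" using a ord_eq_1[OF True] by simp
    ultimately have "ord i = 2"
      using two_is_prime_nat prime_nat_iff by blast
    then show "i \<in> involutions G" using True by (simp add: involutions_def)
  qed
qed (simp add: involutions_def)

lemma involution_closed: "i \<in> involutions G \<Longrightarrow> i \<in> carrier G"
  by (simp add: involutions_iff)

lemma involution_square: "i \<in> involutions G \<Longrightarrow> i \<otimes> i = \<one>"
  by (simp add: involutions_iff)

lemma involution_cancel:
  assumes "i \<in> involutions G" "x \<in> carrier G"
  shows "i \<otimes> (i \<otimes> x) = x"
  using assms by (simp add: involutions_iff flip: m_assoc)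

lemma involution_inv: "i \<in> involutions G \<Longrightarrow> inv i = i"
  by (simp add: involutions_iff inv_equality)

lemma line_through_iff:
  assumes "i \<in> involutions G" "j \<in> involutions G"
  shows "k \<in> line_through G i j \<longleftrightarrow> k \<in> involutions G \<and> k \<otimes> (i \<otimes> j) \<in> involutions G"
proof -
  have "i \<otimes> j \<in> k <# involutions G \<longleftrightarrow> k \<otimes> (i \<otimes> j) \<in> involutions G"
    if k: "k \<in> involutions G"
  proof
    assume "i \<otimes> j \<in> k <# involutions G"
    then obtain r where "r \<in> involutions G" "i \<otimes> j = k \<otimes> r"
      by (auto simp: l_coset_def)
    then show "k \<otimes> (i \<otimes> j) \<in> involutions G"
      using k by (simp add: involution_cancel involution_closed)
  next
    assume "k \<otimes> (i \<otimes> j) \<in> involutions G"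
    moreover have "i \<otimes> j = k \<otimes> (k \<otimes> (i \<otimes> j))"
      using k assms by (simp add: involution_cancel involution_closed)
    ultimately show "i \<otimes> j \<in> k <# involutions G"
      unfolding l_coset_def by blast
  qed
  then show ?thesis by (auto simp: line_through_def)
qed

lemma conjugate_involution:
  assumes p: "p \<in> involutions G" and i: "i \<in> involutions G"
  shows "p \<otimes> (i \<otimes> p) \<in> involutions G"
proof -
  have cl: "p \<in> carrier G" "i \<in> carrier G"
    using p i by (simp_all add: involution_closed)
  have pp: "p \<otimes> p = \<one>" and ii: "i \<otimes> i = \<one>" "i \<noteq> \<one>"
    using p i by (auto simp: involutions_iff)
  have "(p \<otimes> (i \<otimes> p)) \<otimes> (p \<otimes> (i \<otimes> p)) = \<one>"
    using cl p i pp by (simp add: m_assoc involution_cancel)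
  moreover have "p \<otimes> (i \<otimes> p) \<noteq> \<one>"
  proof
    assume "p \<otimes> (i \<otimes> p) = \<one>"
    then have "p \<otimes> (p \<otimes> (i \<otimes> p)) \<otimes> p = p \<otimes> \<one> \<otimes> p" by simp
    then show False using cl p pp ii by (simp add: involution_cancel m_assoc)
  qed
  ultimately show ?thesis using cl by (simp add: involutions_iff)
qed

text \<open>
  Conjugation by \<open>p\<close> maps lines to lines. Since it is its own inverse, the inclusion of the mirror
  image of the conjugated line in the original one is the only direction that has to be proved.
\<close>

lemma line_through_conjugate:
  assumes p: "p \<in> involutions G" and i: "i \<in> involutions G" and j: "j \<in> involutions G"
    and q: "q \<in> line_through G (p \<otimes> (i \<otimes> p)) (p \<otimes> (j \<otimes> p))"
  shows "p \<otimes> (q \<otimes> p) \<in> line_through G i j"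
proof -
  note cl = p i j conjugate_involution[OF p i] conjugate_involution[OF p j]
  have qJ: "q \<in> involutions G"
    and r: "q \<otimes> ((p \<otimes> (i \<otimes> p)) \<otimes> (p \<otimes> (j \<otimes> p))) \<in> involutions G"
    using q line_through_iff[OF cl(4,5)] by auto
  have "p \<otimes> ((q \<otimes> ((p \<otimes> (i \<otimes> p)) \<otimes> (p \<otimes> (j \<otimes> p)))) \<otimes> p) = (p \<otimes> (q \<otimes> p)) \<otimes> (i \<otimes> j)"
    using p i j qJ by (simp add: m_assoc involution_closed involution_cancel involution_square)
  then have "(p \<otimes> (q \<otimes> p)) \<otimes> (i \<otimes> j) \<in> involutions G"
    using conjugate_involution[OF p r] by simp
  then show ?thesis
    using line_through_iff[OF i j] conjugate_involution[OF p qJ] by blast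
qed

text \<open>
  Conjugation by \<open>p\<close> moves each point along a line through \<open>p\<close>; hence a set that is closed under
  taking lines is closed under conjugation by its own elements.
\<close>

lemma reflected_point_in_line_through:
  assumes p: "p \<in> involutions G" and j: "j \<in> involutions G"
  shows "p \<otimes> (j \<otimes> p) \<in> line_through G p j"
proof -
  have "(p \<otimes> (j \<otimes> p)) \<otimes> (p \<otimes> j) = p"
    using p j by (simp add: m_assoc involution_closed involution_cancel involution_square)
  then show ?thesis
    using p conjugate_involution[OF p j] by (simp add: line_through_iff[OF p j])
qed

text \<open>
  That \<open>k i j\<close> is an involution means that \<open>k\<close> inverts \<open>i j\<close> and that \<open>k \<noteq> j i\<close>. The second condition
  is automatic, for if \<open>j i\<close> were an involution then \<open>i\<close> and \<open>j\<close> would commute.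
\<close>

lemma line_through_iff_inverts:
  assumes nc: "\<And>x y. \<lbrakk>x \<in> involutions G; y \<in> involutions G; x \<otimes> y = y \<otimes> x\<rbrakk> \<Longrightarrow> x = y"
    and i: "i \<in> involutions G" and j: "j \<in> involutions G" and "i \<noteq> j"
  shows "k \<in> line_through G i j \<longleftrightarrow> k \<in> involutions G \<and> k \<otimes> (i \<otimes> j) = (j \<otimes> i) \<otimes> k"
proof (cases "k \<in> involutions G")
  case True
  note cl = True[THEN involution_closed] i[THEN involution_closed] j[THEN involution_closed]
  have inv_ij: "inv (i \<otimes> j) = j \<otimes> i"
    using i j by (simp add: involution_closed inv_mult_group involution_inv)
  have "k \<otimes> (i \<otimes> j) \<noteq> \<one>"
  proof
    assume "k \<otimes> (i \<otimes> j) = \<one>"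
    then have "k \<otimes> (k \<otimes> (i \<otimes> j)) = k \<otimes> \<one>" by simp
    then have "i \<otimes> j = k" using True cl by (simp add: involution_cancel)
    then have "inv (i \<otimes> j) = i \<otimes> j" using True involution_inv by simp
    then have "i \<otimes> j = j \<otimes> i" using inv_ij by simp
    then show False using nc i j \<open>i \<noteq> j\<close> by blast
  qed
  moreover have "(k \<otimes> (i \<otimes> j)) \<otimes> (k \<otimes> (i \<otimes> j)) = \<one> \<longleftrightarrow> k \<otimes> (i \<otimes> j) = (j \<otimes> i) \<otimes> k"
  proof -
    have "(k \<otimes> (i \<otimes> j)) \<otimes> (k \<otimes> (i \<otimes> j)) = \<one> \<longleftrightarrow> k \<otimes> (i \<otimes> j) = inv (k \<otimes> (i \<otimes> j))"
      using cl by (metis inv_equality m_closed r_inv)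
    also have "inv (k \<otimes> (i \<otimes> j)) = (j \<otimes> i) \<otimes> k"
      using cl True inv_ij by (simp add: inv_mult_group[of k "i \<otimes> j"] involution_inv)
    finally show ?thesis .
  qed
  ultimately show ?thesis
    using True cl by (simp add: line_through_iff[OF i j] involutions_iff[of "k \<otimes> (i \<otimes> j)"])
qed (simp add: line_through_def)

text \<open>
  The involution \<open>p\<close> interchanges \<open>q\<close> and \<open>p q p\<close>, and so plays the role of their midpoint. Both of
  them invert \<open>\<tau> = i j\<close>, so their product \<open>q (p q p) = (q p)\<^sup>2\<close> commutes with \<open>\<tau>\<close>. It also commutes
  with \<open>q p\<close>, and being the product of two distinct involutions it is a nontrivial translation;
  transitivity of commuting passes from this square to its root: \<open>q p\<close> commutes with \<open>\<tau>\<close>. Therefore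
  \<open>p = q (q p)\<close> inverts \<open>\<tau>\<close> because \<open>q\<close> does.
\<close>

lemma midpoint_in_line_through:
  assumes nc: "\<And>x y. \<lbrakk>x \<in> involutions G; y \<in> involutions G; x \<otimes> y = y \<otimes> x\<rbrakk> \<Longrightarrow> x = y"
    and ct: "commuting_transitive_on G (group_translations G - {\<one>})"
    and i: "i \<in> involutions G" and j: "j \<in> involutions G" and "i \<noteq> j"
    and p: "p \<in> involutions G"
    and q: "q \<in> line_through G i j" and q': "p \<otimes> (q \<otimes> p) \<in> line_through G i j"
  shows "p \<in> line_through G i j"
proof (cases "p = q")
  case True
  then show ?thesis using q by simp
next
  case False
  define \<tau> where "\<tau> = i \<otimes> j"
  define \<tau>' where "\<tau>' = j \<otimes> i"
  define \<rho> where "\<rho> = q \<otimes> p"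
  note in_line = line_through_iff_inverts[OF nc i j \<open>i \<noteq> j\<close>, folded \<tau>_def \<tau>'_def]
  have qJ: "q \<in> involutions G" using q in_line by blast
  have cl: "i \<in> carrier G" "j \<in> carrier G" "p \<in> carrier G" "q \<in> carrier G"
      "\<tau> \<in> carrier G" "\<tau>' \<in> carrier G" "\<rho> \<in> carrier G"
    using i j p qJ by (simp_all add: involution_closed \<tau>_def \<tau>'_def \<rho>_def)
  have q\<tau>: "q \<otimes> \<tau> = \<tau>' \<otimes> q" and q'\<tau>: "(p \<otimes> (q \<otimes> p)) \<otimes> \<tau> = \<tau>' \<otimes> (p \<otimes> (q \<otimes> p))"
    using in_line[of q] in_line[of "p \<otimes> (q \<otimes> p)"] q q' by blast+
  have q\<tau>': "q \<otimes> \<tau>' = \<tau> \<otimes> q"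
  proof -
    have "q \<otimes> (q \<otimes> \<tau>) \<otimes> q = q \<otimes> (\<tau>' \<otimes> q) \<otimes> q" using q\<tau> by simp
    then show ?thesis
      using cl qJ by (simp add: involution_cancel m_assoc involution_square)
  qed
  have \<rho>\<rho>: "\<rho> \<otimes> \<rho> = q \<otimes> (p \<otimes> (q \<otimes> p))"
    using cl by (simp add: \<rho>_def m_assoc)
  have "(\<rho> \<otimes> \<rho>) \<otimes> \<tau> = q \<otimes> ((p \<otimes> (q \<otimes> p)) \<otimes> \<tau>)"
    unfolding \<rho>\<rho> using cl by (simp add: m_assoc)
  also have "\<dots> = (q \<otimes> \<tau>') \<otimes> (p \<otimes> (q \<otimes> p))"
    unfolding q'\<tau> using cl by (simp add: m_assoc)
  also have "\<dots> = \<tau> \<otimes> (\<rho> \<otimes> \<rho>)"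
    unfolding q\<tau>' \<rho>\<rho> using cl by (simp add: m_assoc)
  finally have comm1: "(\<rho> \<otimes> \<rho>) \<otimes> \<tau> = \<tau> \<otimes> (\<rho> \<otimes> \<rho>)" .
  have comm2: "\<rho> \<otimes> (\<rho> \<otimes> \<rho>) = (\<rho> \<otimes> \<rho>) \<otimes> \<rho>"
    using cl by (simp add: m_assoc)
  have ne: "x \<otimes> y \<noteq> \<one>" if "x \<in> involutions G" "y \<in> involutions G" "x \<noteq> y" for x y
  proof
    assume "x \<otimes> y = \<one>"
    then have "inv y = x" using that by (intro inv_equality) (auto simp: involution_closed)
    then show False using that involution_inv by simp
  qed
  have trans: "x \<otimes> y \<in> group_translations G - {\<one>}"
    if "x \<in> involutions G" "y \<in> involutions G" "x \<noteq> y" for x y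
    using ne[OF that] that unfolding group_translations_def set_mult_def by blast
  have "q \<noteq> p \<otimes> (q \<otimes> p)"
  proof
    assume "q = p \<otimes> (q \<otimes> p)"
    then have "p \<otimes> q = p \<otimes> (p \<otimes> (q \<otimes> p))" by simp
    then have "p \<otimes> q = q \<otimes> p" using cl p by (simp add: involution_cancel)
    then show False using nc p qJ False by blast
  qed
  then have "\<rho> \<otimes> \<rho> \<in> group_translations G - {\<one>}"
    using trans[OF qJ conjugate_involution[OF p qJ]] \<rho>\<rho> by simp
  moreover have "\<rho> \<in> group_translations G - {\<one>}" "\<tau> \<in> group_translations G - {\<one>}"
    using trans[OF qJ p] trans[OF i j \<open>i \<noteq> j\<close>] False by (auto simp: \<rho>_def \<tau>_def)
  ultimately have comm: "\<rho> \<otimes> \<tau> = \<tau> \<otimes> \<rho>"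
    using ct comm1 comm2 unfolding commuting_transitive_on_def by blast
  have p_eq: "p = q \<otimes> \<rho>"
    using cl qJ by (simp add: \<rho>_def involution_cancel)
  have "p \<otimes> \<tau> = q \<otimes> (\<tau> \<otimes> \<rho>)"
    using cl by (simp add: p_eq m_assoc flip: comm)
  also have "\<dots> = (q \<otimes> \<tau>) \<otimes> \<rho>" using cl by (simp add: m_assoc)
  also have "\<dots> = \<tau>' \<otimes> p" unfolding q\<tau> p_eq using cl by (simp add: m_assoc)
  finally show ?thesis using p in_line by blast
qed

text \<open>
  Any \<open>p\<close> in \<open>S\<close> lies on \<open>M\<close>: the mirror image \<open>p M p\<close> is also a line in \<open>S\<close>, and a point \<open>q\<close> common
  to \<open>M\<close> and \<open>p M p\<close> has \<open>p\<close> as the midpoint between itself and \<open>p q p\<close>, which is again on \<open>M\<close>.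
\<close>

lemma plane_subset_line:
  assumes nc: "\<And>x y. \<lbrakk>x \<in> involutions G; y \<in> involutions G; x \<otimes> y = y \<otimes> x\<rbrakk> \<Longrightarrow> x = y"
    and ct: "commuting_transitive_on G (group_translations G - {\<one>})"
    and S: "S \<subseteq> involutions G"
    and closed: "\<forall>i\<in>S. \<forall>j\<in>S. i \<noteq> j \<longrightarrow> line_through G i j \<subseteq> S"
    and meet: "\<forall>L\<in>lines G. \<forall>M\<in>lines G. L \<subseteq> S \<and> M \<subseteq> S \<longrightarrow> L \<inter> M \<noteq> {}"
    and M: "M \<in> lines G" "M \<subseteq> S"
  shows "S \<subseteq> M"
proof
  fix p assume "p \<in> S"
  with S have p: "p \<in> involutions G" by blast
  obtain i j where i: "i \<in> involutions G" and j: "j \<in> involutions G" and "i \<noteq> j"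
    and M_eq: "M = line_through G i j"
    using M(1) unfolding lines_def by blast
  define M' where "M' = line_through G (p \<otimes> (i \<otimes> p)) (p \<otimes> (j \<otimes> p))"
  have refl_S: "p \<otimes> (x \<otimes> p) \<in> S" if "x \<in> S" for x
  proof (cases "x = p")
    case True
    then show ?thesis using \<open>p \<in> S\<close> p by (simp add: involution_cancel involution_closed)
  next
    case False
    then have "line_through G p x \<subseteq> S"
      using closed \<open>p \<in> S\<close> that by simp
    moreover have "p \<otimes> (x \<otimes> p) \<in> line_through G p x"
      using S that by (intro reflected_point_in_line_through[OF p]) (rule subsetD)
    ultimately show ?thesis by (rule subsetD)
  qed
  have refl_refl: "p \<otimes> ((p \<otimes> (x \<otimes> p)) \<otimes> p) = x" if "x \<in> involutions G" for x
    using p that by (simp add: m_assoc involution_closed involution_cancel involution_square)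
  have refl_M: "p \<otimes> (x \<otimes> p) \<in> M" if "x \<in> M'" for x
    using line_through_conjugate[OF p i j] that unfolding M'_def M_eq by blast
  have "p \<otimes> (i \<otimes> p) \<noteq> p \<otimes> (j \<otimes> p)"
    using refl_refl[OF i] refl_refl[OF j] \<open>i \<noteq> j\<close> by metis
  then have "M' \<in> lines G"
    using conjugate_involution[OF p] i j unfolding M'_def lines_def by blast
  moreover have "M' \<subseteq> S"
  proof
    fix x assume "x \<in> M'"
    then have "p \<otimes> (x \<otimes> p) \<in> S" using refl_M M(2) by blast
    moreover have "x \<in> involutions G" using \<open>x \<in> M'\<close> by (simp add: M'_def line_through_def)
    ultimately show "x \<in> S" using refl_S refl_refl by metis
  qed
  ultimately obtain q where "q \<in> M" "q \<in> M'" using meet M by blast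
  then show "p \<in> M"
    using midpoint_in_line_through[OF nc ct i j \<open>i \<noteq> j\<close> p] refl_M unfolding M_eq by blast
qed

end

section \<open>Commuting involutions of a sharply 2-transitive group\<close>

sublocale sharply_2_transitive \<subseteq> group G
  using group_hom by (rule group_hom.axioms(1))

context sharply_2_transitive
begin

lemma action_closed: "\<lbrakk>g \<in> carrier G; x \<in> \<Omega>\<rbrakk> \<Longrightarrow> \<phi> g x \<in> \<Omega>"
  using element_image by blast

lemma action_comp: "\<lbrakk>g \<in> carrier G; h \<in> carrier G; x \<in> \<Omega>\<rbrakk> \<Longrightarrow> \<phi> (g \<otimes> h) x = \<phi> g (\<phi> h x)"
  by (simp add: composition_rule)

lemma action_one: "x \<in> \<Omega> \<Longrightarrow> \<phi> \<one> x = x"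
  by (simp flip: id_eq_one)

lemma action_inv: "\<lbrakk>g \<in> carrier G; x \<in> \<Omega>\<rbrakk> \<Longrightarrow> \<phi> (inv g) (\<phi> g x) = x"
  using orbit_sym_aux by blast

lemma eq_if_agree_on_pair:
  assumes "g \<in> carrier G" "h \<in> carrier G" "a \<in> \<Omega>" "b \<in> \<Omega>" "a \<noteq> b"
    and "\<phi> g a = \<phi> h a" "\<phi> g b = \<phi> h b"
  shows "g = h"
proof -
  have "\<phi> h a \<noteq> \<phi> h b"
    using assms action_inv by metis
  moreover have "\<phi> h a \<in> \<Omega>" "\<phi> h b \<in> \<Omega>"
    using assms action_closed by blast+
  ultimately show ?thesis
    using regular_on_pairs[of a b "\<phi> h a" "\<phi> h b"] assms by blast
qed

lemma involution_apply_twice: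
  assumes "i \<in> involutions G" "x \<in> \<Omega>"
  shows "\<phi> i (\<phi> i x) = x"
  using assms action_inv[of i x] by (simp add: involution_inv involution_closed)

lemma involution_fixes_at_most_one_point:
  assumes i: "i \<in> involutions G" and "a \<in> \<Omega>" "b \<in> \<Omega>" "\<phi> i a = a" "\<phi> i b = b"
  shows "a = b"
proof (rule ccontr)
  assume "a \<noteq> b"
  moreover have "\<phi> \<one> a = a" "\<phi> \<one> b = b"
    using assms(2,3) by (simp_all add: action_one)
  ultimately have "i = \<one>"
    using eq_if_agree_on_pair[of i \<one> a b] assms involution_closed by auto
  then show False using i by (simp add: involutions_iff)
qed

text \<open>
  If \<open>i\<close> swaps \<open>a\<close> and \<open>b\<close> while \<open>j\<close> swaps their images under \<open>g\<close>, then \<open>g i\<close> and \<open>j g\<close> agree on the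
  pair \<open>a\<close>, \<open>b\<close>. Since \<open>g\<close> can be chosen to carry any pair to any other, this makes all
  involutions conjugate, with control over the conjugating element.
\<close>

lemma conjugate_involution_if_swaps:
  assumes i: "i \<in> involutions G" and j: "j \<in> involutions G" and g: "g \<in> carrier G"
    and a: "a \<in> \<Omega>" and b: "b \<in> \<Omega>" "b \<noteq> a" "\<phi> i a = b" and jg: "\<phi> j (\<phi> g a) = \<phi> g b"
  shows "g \<otimes> i = j \<otimes> g"
proof -
  have ib: "\<phi> i b = a" using involution_apply_twice[OF i a] b by simp
  have "\<phi> j (\<phi> g b) = \<phi> g a"
    using involution_apply_twice[OF j, of "\<phi> g a"] jg action_closed[OF g a] by simp
  then show ?thesis
    using eq_if_agree_on_pair[of "g \<otimes> i" "j \<otimes> g" a b] assms ib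
    by (simp add: action_comp involution_closed)
qed

text \<open>
  If \<open>i\<close> had no fixed point, it would move \<open>c\<close>, and an element that carries a pair swapped by \<open>j\<close> to
  the pair \<open>c\<close>, \<open>i c\<close> would carry the fixed point of \<open>j\<close> to one of \<open>i\<close>.
\<close>

lemma involution_has_fixed_point:
  assumes j: "j \<in> involutions G" and c: "c \<in> \<Omega>" "\<phi> j c = c" and i: "i \<in> involutions G"
  shows "\<exists>a\<in>\<Omega>. \<phi> i a = a"
proof (rule ccontr)
  assume no: "\<not> ?thesis"
  obtain d where d: "d \<in> \<Omega>" "d \<noteq> c"
    using two_points by metis
  have jd: "\<phi> j d \<noteq> d" "\<phi> j d \<in> \<Omega>"
    using involution_fixes_at_most_one_point[OF j] c d action_closed j involution_closed by blast+
  have ic: "\<phi> i c \<noteq> c" "\<phi> i c \<in> \<Omega>"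
    using no c(1) action_closed i involution_closed by blast+
  obtain g where g: "g \<in> carrier G" "\<phi> g d = c" "\<phi> g (\<phi> j d) = \<phi> i c"
    using regular_on_pairs[of d "\<phi> j d" c "\<phi> i c"] c d jd ic by metis
  have "g \<otimes> j = i \<otimes> g"
    using conjugate_involution_if_swaps[OF j i g(1) d(1) jd(2,1) refl] g by simp
  then have "\<phi> i (\<phi> g c) = \<phi> g c"
    using c g i j by (metis action_comp involution_closed)
  then show False using no action_closed g(1) c(1) by blast
qed

text \<open>
  Choose \<open>b \<noteq> a\<close> and let \<open>g\<close> map the pair \<open>b\<close>, \<open>i b\<close> to the pair \<open>b\<close>, \<open>j b\<close>. It conjugates \<open>i\<close> to \<open>j\<close>,
  so it maps the only fixed point of \<open>i\<close> to that of \<open>j\<close>: it fixes \<open>a\<close> as well as \<open>b\<close>, and is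
  trivial.
\<close>

lemma involution_eq_if_same_fixed_point:
  assumes i: "i \<in> involutions G" and j: "j \<in> involutions G"
    and a: "a \<in> \<Omega>" "\<phi> i a = a" "\<phi> j a = a"
  shows "i = j"
proof -
  obtain b where b: "b \<in> \<Omega>" "b \<noteq> a"
    using two_points by metis
  have ib: "\<phi> i b \<noteq> b" "\<phi> i b \<in> \<Omega>" and jb: "\<phi> j b \<noteq> b" "\<phi> j b \<in> \<Omega>"
    using involution_fixes_at_most_one_point[OF i] involution_fixes_at_most_one_point[OF j]
      a b action_closed i j involution_closed by blast+
  obtain g where g: "g \<in> carrier G" "\<phi> g b = b" "\<phi> g (\<phi> i b) = \<phi> j b"
    using regular_on_pairs[of b "\<phi> i b" b "\<phi> j b"] b ib jb by metis
  have gi: "g \<otimes> i = j \<otimes> g"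
    using conjugate_involution_if_swaps[OF i j g(1) b(1) ib(2,1) refl] g by simp
  then have "\<phi> j (\<phi> g a) = \<phi> g a"
    using a g i j by (metis action_comp involution_closed)
  then have "\<phi> g a = a"
    using involution_fixes_at_most_one_point[OF j] a g action_closed by blast
  moreover have "\<phi> \<one> a = a" "\<phi> \<one> b = b"
    using a b by (simp_all add: action_one)
  ultimately have "g = \<one>"
    using eq_if_agree_on_pair[of g \<one> a b] a b g by simp
  then show ?thesis using gi i j involution_closed by simp
qed

lemma commuting_involutions_eq:
  assumes "s2t_char G \<Omega> \<phi> \<noteq> 2"
    and i: "i \<in> involutions G" and j: "j \<in> involutions G" and comm: "i \<otimes> j = j \<otimes> i"
  shows "i = j"
proof -
  obtain k where k: "k \<in> involutions G" "invariants \<Omega> \<phi> k \<noteq> {}"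
    using assms(1) unfolding s2t_char_def by (auto split: if_splits)
  then obtain c where "c \<in> \<Omega>" "\<phi> k c = c"
    unfolding invariants_def by blast
  then obtain a where a: "a \<in> \<Omega>" "\<phi> i a = a"
    using involution_has_fixed_point k(1) i by blast
  have "\<phi> i (\<phi> j a) = \<phi> j a"
    using a comm i j by (metis action_comp involution_closed)
  then have "\<phi> j a = a"
    using involution_fixes_at_most_one_point[OF i] a action_closed j involution_closed by blast
  then show ?thesis using involution_eq_if_same_fixed_point i j a by blast
qed

end

theorem proposition3p4:
  fixes G :: "('a, 'm) monoid_scheme"
    and \<Omega> :: "'b set"
    and \<phi> :: "'a \<Rightarrow> 'b \<Rightarrow> 'b"
    and S :: "'a set"
  assumes "sharply_2_transitive G \<Omega> \<phi>"
    and "s2t_char G \<Omega> \<phi> \<noteq> 2"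
    and "commuting_transitive_on G (group_translations G - {\<one>\<^bsub>G\<^esub>})"
    and "S \<subseteq> involutions G"
    and "\<forall>i\<in>S. \<forall>j\<in>S. i \<noteq> j \<longrightarrow> line_through G i j \<subseteq> S"
    and "\<forall>L\<in>lines G. \<forall>M\<in>lines G. L \<subseteq> S \<and> M \<subseteq> S \<longrightarrow> L \<inter> M \<noteq> {}"
  shows "\<forall>L\<in>lines G. \<forall>M\<in>lines G. L \<subseteq> S \<and> M \<subseteq> S \<longrightarrow> L = M"
proof -
  interpret sharply_2_transitive G \<Omega> \<phi> by fact
  have "S \<subseteq> M" if "M \<in> lines G" "M \<subseteq> S" for M
    using plane_subset_line[OF commuting_involutions_eq[OF assms(2)] assms(3-6) that] .
  then show ?thesis by blast
qed

end
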